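(* Let $f:\mathbb{B}\to\mathbb{H}$ be an arbitrary function and assume that the $3\times3$ dual Pick matrices $\widetilde P_f(z_1,z_2,z_3)$ are positive semidefinite for all $(z_1,z_2,z_3)\in\mathbb{B}^3$. Then there is a unique formal power series $g\in\mathcal{QS}$ such that $f(\alpha)=g^{e_r}(\alpha)$ for all $\alpha\in\mathbb{B}$.
   Context: $\mathbb{H}$ denotes the real quaternions, $\bar\alpha$ the quaternionic conjugate, $|\alpha|^2=\alpha\bar\alpha$, $\mathbb{B}=\{\alpha\in\mathbb{H}:|\alpha|<1\}$. The dual Pick matrix is $\widetilde P_f(z_1,\dots,z_n)=\Big[\sum_{k=0}^\infty \bar z_i^{\,k}(1-\overline{f(z_i)}f(z_j))z_j^k\Big]_{i,j=1}^n$. A quaternionic matrix $A$ is positive semidefinite if $A=A^*$ and $x^*Ax\ge0$ for all quaternionic vectors $x$. $\mathbb{H}[[z]]$ denotes formal power series $g(z)=\sum_{k\ge0}z^kg_k$ in a variable $z$ commuting with the coefficients $g_k\in\mathbb{H}$, with $\limsup_k\sqrt[k]{|g_k|}\le1$. The right evaluation is $g^{e_r}(\alpha)=\sum_{k\ge0}g_k\alpha^k$ and the left evaluation is $g^{e_\ell}(\alpha)=\sum_{k\ge0}\alpha^kg_k$. For such $g$ let $T_n(g)$ be the $n\times n$ lower triangular Toeplitz matrix with $(i,j)$ entry $g_{i-j}$ for $i\ge j$ and $0$ otherwise. The Schur class $\mathcal{QS}$ is the set of $g\in\mathbb{H}[[z]]$ such that $T_n(g)$ is contractive (i.e. $I_n-T_n(g)T_n(g)^*$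 is positive semidefinite) for all $n\ge1$; equivalently (a known result), $|g^{e_\ell}(\alpha)|\le1$ for all $\alpha\in\mathbb{B}$, equivalently $|g^{e_r}(\alpha)|\le 1$ for all $\alpha\in\mathbb{B}$. *)

theory Defs
  imports "HOL-Analysis.Analysis"
begin

datatype quat = Quat (qre: real) (qi: real) (qj: real) (qk: real)

lemma quat_eq_iff: "x = y \<longleftrightarrow> qre x = qre y \<and> qi x = qi y \<and> qj x = qj y \<and> qk x = qk y"
  by (cases x; cases y) auto

instantiation quat :: ring_1
begin
definition "0 = Quat 0 0 0 0"
definition "1 = Quat 1 0 0 0"
definition "x + y = Quat (qre x + qre y) (qi x + qi y) (qj x + qj y) (qk x + qk y)"
definition "x - y = Quat (qre x - qre y) (qi x - qi y) (qj x - qj y) (qk x - qk y)"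
definition "- x = Quat (- qre x) (- qi x) (- qj x) (- qk x)"
definition "x * y = Quat
   (qre x * qre y - qi x * qi y - qj x * qj y - qk x * qk y)
   (qre x * qi y + qi x * qre y + qj x * qk y - qk x * qj y)
   (qre x * qj y - qi x * qk y + qj x * qre y + qk x * qi y)
   (qre x * qk y + qi x * qj y - qj x * qi y + qk x * qre y)"
instance
  by standard (simp_all add: quat_eq_iff zero_quat_def one_quat_def plus_quat_def
      minus_quat_def uminus_quat_def times_quat_def algebra_simps)
end

lemma quat_simps [simp]:
  "qre 0 = 0" "qi 0 = 0" "qj 0 = 0" "qk 0 = 0"
  "qre 1 = 1" "qi 1 = 0" "qj 1 = 0" "qk 1 = 0"
  "qre (x + y) = qre x + qre y" "qi (x + y) = qi x + qi y"
  "qj (x + y) = qj x + qj y" "qk (x + y) = qk x + qk y"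
  "qre (x - y) = qre x - qre y" "qi (x - y) = qi x - qi y"
  "qj (x - y) = qj x - qj y" "qk (x - y) = qk x - qk y"
  "qre (- x) = - qre x" "qi (- x) = - qi x" "qj (- x) = - qj x" "qk (- x) = - qk x"
  by (simp_all add: zero_quat_def one_quat_def plus_quat_def minus_quat_def uminus_quat_def)

definition qvec :: "quat \<Rightarrow> real \<times> real \<times> real \<times> real" where
  "qvec x = (qre x, qi x, qj x, qk x)"

instantiation quat :: real_normed_vector
begin
definition "scaleR r x = Quat (r * qre x) (r * qi x) (r * qj x) (r * qk x)"
definition "norm x = norm (qvec x)"
definition "sgn x = scaleR (inverse (norm x)) (x :: quat)"
definition dist_quat_def: "dist x y = norm (x - y :: quat)"
definition uniformity_quat_def:
  "(uniformity :: (quat \<times> quat) filter) = (INF e\<in>{0 <..}. principal {(x, y). dist x y < e})"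
definition open_quat_def:
  "open (U :: quat set) \<longleftrightarrow> (\<forall>x\<in>U. eventually (\<lambda>(x', y). x' = x \<longrightarrow> y \<in> U) uniformity)"
instance
proof
  fix r s :: real and x y :: quat
  show "scaleR r (x + y) = scaleR r x + scaleR r y"
    by (simp add: quat_eq_iff scaleR_quat_def algebra_simps)
  show "scaleR (r + s) x = scaleR r x + scaleR s x"
    by (simp add: quat_eq_iff scaleR_quat_def algebra_simps)
  show "scaleR r (scaleR s x) = scaleR (r * s) x"
    by (simp add: quat_eq_iff scaleR_quat_def algebra_simps)
  show "scaleR 1 x = x"
    by (simp add: quat_eq_iff scaleR_quat_def)
  show "(norm x = 0) = (x = 0)"
    by (simp add: norm_quat_def qvec_def quat_eq_iff zero_prod_def)
  have "qvec (x + y) = qvec x + qvec y" by (simp add: qvec_def)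
  then show "norm (x + y) \<le> norm x + norm y"
    by (simp add: norm_quat_def norm_triangle_ineq)
  have "qvec (scaleR r x) = scaleR r (qvec x)" by (simp add: qvec_def scaleR_quat_def)
  then show "norm (scaleR r x) = \<bar>r\<bar> * norm x"
    by (simp add: norm_quat_def)
qed (simp_all add: sgn_quat_def dist_quat_def open_quat_def uniformity_quat_def)
end

definition qcnj :: "quat \<Rightarrow> quat" where
  "qcnj x = Quat (qre x) (- qi x) (- qj x) (- qk x)"

definition quat_of_real :: "real \<Rightarrow> quat" where
  "quat_of_real r = Quat r 0 0 0"

definition qball :: "quat set" where
  "qball = {a. norm a < 1}"

definition qnonneg :: "quat \<Rightarrow> bool" where
  "qnonneg q \<longleftrightarrow> qi q = 0 \<and> qj q = 0 \<and> qk q = 0 \<and> qre q \<ge> 0"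

definition qpsd :: "nat \<Rightarrow> (nat \<Rightarrow> nat \<Rightarrow> quat) \<Rightarrow> bool" where
  "qpsd n A \<longleftrightarrow>
     (\<forall>i<n. \<forall>j<n. A i j = qcnj (A j i)) \<and>
     (\<forall>x :: nat \<Rightarrow> quat. qnonneg (\<Sum>i<n. \<Sum>j<n. qcnj (x i) * A i j * x j))"

definition dual_pick :: "(quat \<Rightarrow> quat) \<Rightarrow> quat list \<Rightarrow> nat \<Rightarrow> nat \<Rightarrow> quat" where
  "dual_pick f zs i j =
     (\<Sum>k. qcnj (zs ! i) ^ k * (1 - qcnj (f (zs ! i)) * f (zs ! j)) * (zs ! j) ^ k)"

definition qfps :: "(nat \<Rightarrow> quat) \<Rightarrow> bool" where
  "qfps g \<longleftrightarrow> limsup (\<lambda>k. ereal (root k (norm (g k)))) \<le> 1"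

definition eval_r :: "(nat \<Rightarrow> quat) \<Rightarrow> quat \<Rightarrow> quat" where
  "eval_r g a = (\<Sum>k. g k * a ^ k)"

definition toeplitz :: "(nat \<Rightarrow> quat) \<Rightarrow> nat \<Rightarrow> nat \<Rightarrow> quat" where
  "toeplitz g i j = (if j \<le> i then g (i - j) else 0)"

text \<open>Schur class QS: T_n(g) contractive, i.e. I_n - T_n(g) T_n(g)^* psd, for all n \<ge> 1.\<close>
definition QS :: "(nat \<Rightarrow> quat) set" where
  "QS = {g. qfps g \<and>
     (\<forall>n\<ge>1. qpsd n (\<lambda>i j. (if i = j then 1 else 0) -
                 (\<Sum>l<n. toeplitz g i l * qcnj (toeplitz g j l))))}"

end

theory Submission
  imports Defs "HOL-Complex_Analysis.Complex_Analysis" "HOL-Real_Asymp.Real_Asymp"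
begin

text \<open>
  Positivity of the Pick matrix says \<open>\<Sum>\<^sub>k |\<Sum>\<^sub>j f(z\<^sub>j) z\<^sub>j\<^sup>k x\<^sub>j|\<^sup>2 \<le> \<Sum>\<^sub>k |\<Sum>\<^sub>j z\<^sub>j\<^sup>k x\<^sub>j|\<^sup>2\<close>.
  On a complex slice, the weights \<open>x\<^sub>j = 1 / \<Prod>\<^sub>l\<^sub>\<noteq>\<^sub>j (z\<^sub>j - z\<^sub>l)\<close> turn this into a bound on the second
  divided differences of \<open>f\<close>; hence the first difference quotients are Lipschitz, \<open>f\<close> is complex
  differentiable on the slice, and it has a power series \<open>g\<close> there. If \<open>z\<^sub>1, z\<^sub>2, z\<^sub>3\<close> lie on one
  sphere of conjugate quaternions, there are weights annihilating the right-hand side, so \<open>f\<close> on the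
  sphere is determined by two values, in the same way as the right evaluation of \<open>g\<close>; so the
  expansion holds on the whole ball. Finally, \<open>\<Sum>\<^sub>k g\<^sub>k q z\<^sup>k = f(q z q\<^sup>-\<^sup>1) q\<close> and \<open>|f| \<le> 1\<close> show that
  convolution with \<open>g\<close> does not increase the modulus on circles, and Parseval's identity makes the
  Toeplitz matrices contractive.
\<close>

section \<open>The quaternions as a complete normed division algebra\<close>

lemma norm_quat: "norm (x::quat) = sqrt ((qre x)\<^sup>2 + (qi x)\<^sup>2 + (qj x)\<^sup>2 + (qk x)\<^sup>2)"
  by (simp add: norm_quat_def qvec_def norm_prod_def add.assoc)

lemma norm_quat_power2: "(norm (x::quat))\<^sup>2 = (qre x)\<^sup>2 + (qi x)\<^sup>2 + (qj x)\<^sup>2 + (qk x)\<^sup>2"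
  by (simp add: norm_quat)

lemma quat_mult_simps [simp]:
  "qre (x * y) = qre x * qre y - qi x * qi y - qj x * qj y - qk x * qk y"
  "qi (x * y) = qre x * qi y + qi x * qre y + qj x * qk y - qk x * qj y"
  "qj (x * y) = qre x * qj y - qi x * qk y + qj x * qre y + qk x * qi y"
  "qk (x * y) = qre x * qk y + qi x * qj y - qj x * qi y + qk x * qre y"
  by (simp_all add: times_quat_def)

lemma quat_scaleR_simps [simp]:
  "qre (r *\<^sub>R x) = r * qre x" "qi (r *\<^sub>R x) = r * qi x"
  "qj (r *\<^sub>R x) = r * qj x" "qk (r *\<^sub>R x) = r * qk x"
  by (simp_all add: scaleR_quat_def)

lemma qcnj_simps [simp]:
  "qre (qcnj x) = qre x" "qi (qcnj x) = - qi x" "qj (qcnj x) = - qj x" "qk (qcnj x) = - qk x"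
  by (simp_all add: qcnj_def)

lemma quat_mult_qcnj: "x * qcnj x = (norm x)\<^sup>2 *\<^sub>R 1"
  unfolding norm_quat_power2 by (simp add: quat_eq_iff power2_eq_square)

lemma qcnj_mult_quat: "qcnj x * x = (norm x)\<^sup>2 *\<^sub>R 1"
  unfolding norm_quat_power2 by (simp add: quat_eq_iff power2_eq_square)

instance quat :: real_algebra_1
  by standard (simp_all add: quat_eq_iff algebra_simps)

instantiation quat :: real_normed_div_algebra
begin
definition "inverse x = inverse ((norm x)\<^sup>2) *\<^sub>R qcnj (x::quat)"
definition "divide x y = x * inverse (y::quat)"
instance
proof
  fix x y :: quat
  show "inverse (0::quat) = 0"
    by (simp add: inverse_quat_def)
  show "x div y = x * inverse y"
    by (simp add: divide_quat_def)
  show "x \<noteq> 0 \<Longrightarrow> inverse x * x = 1" "x \<noteq> 0 \<Longrightarrow> x * inverse x = 1"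
    by (simp_all add: inverse_quat_def qcnj_mult_quat quat_mult_qcnj)
  show "norm (x * y) = norm x * norm y"
  proof (rule power2_eq_imp_eq)
    \<comment> \<open>Euler's four-square identity.\<close>
    show "(norm (x * y))\<^sup>2 = (norm x * norm y)\<^sup>2"
      unfolding power_mult_distrib norm_quat_power2 quat_mult_simps by algebra
  qed simp_all
qed
end

lemma norm_qcnj [simp]: "norm (qcnj x) = norm x"
  by (simp add: norm_quat)

lemma qcnj_algebra [simp]:
  "qcnj 0 = 0" "qcnj 1 = 1" "qcnj (x + y) = qcnj x + qcnj y" "qcnj (x - y) = qcnj x - qcnj y"
  "qcnj (x * y) = qcnj y * qcnj x" "qcnj (qcnj x) = x"
  by (simp_all add: quat_eq_iff)

lemma qcnj_power: "qcnj (x ^ k) = qcnj x ^ k"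
  by (induction k) (simp_all add: power_commutes)

lemma qcnj_sum: "qcnj (sum f A) = (\<Sum>x\<in>A. qcnj (f x))"
  by (induction A rule: infinite_finite_induct) simp_all

lemma qre_le_norm: "\<bar>qre x\<bar> \<le> norm x" and qi_le_norm: "\<bar>qi x\<bar> \<le> norm x"
  and qj_le_norm: "\<bar>qj x\<bar> \<le> norm x" and qk_le_norm: "\<bar>qk x\<bar> \<le> norm x"
  by (rule power2_le_imp_le; simp add: norm_quat_power2)+

lemma bounded_linear_qre: "bounded_linear qre"
  by (rule bounded_linear_intro[where K = 1]) (simp_all add: qre_le_norm)

lemma bounded_linear_qi: "bounded_linear qi"
  by (rule bounded_linear_intro[where K = 1]) (simp_all add: qi_le_norm)

lemma bounded_linear_qj: "bounded_linear qj"
  by (rule bounded_linear_intro[where K = 1]) (simp_all add: qj_le_norm)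

lemma bounded_linear_qk: "bounded_linear qk"
  by (rule bounded_linear_intro[where K = 1]) (simp_all add: qk_le_norm)

lemma norm_quat_le: "norm x \<le> \<bar>qre x\<bar> + \<bar>qi x\<bar> + \<bar>qj x\<bar> + \<bar>qk x\<bar>"
proof -
  have "x = qre x *\<^sub>R 1 + qi x *\<^sub>R Quat 0 1 0 0 + qj x *\<^sub>R Quat 0 0 1 0 + qk x *\<^sub>R Quat 0 0 0 1"
    by (simp add: quat_eq_iff)
  also have "norm \<dots> \<le> norm (qre x *\<^sub>R (1::quat)) + norm (qi x *\<^sub>R Quat 0 1 0 0)
      + norm (qj x *\<^sub>R Quat 0 0 1 0) + norm (qk x *\<^sub>R Quat 0 0 0 1)"
    by (intro norm_triangle_le add_mono order.refl)
  finally show ?thesis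
    by (simp add: norm_quat)
qed

instance quat :: banach
proof
  fix X :: "nat \<Rightarrow> quat"
  assume X: "Cauchy X"
  have conv: "\<exists>l. (\<lambda>n. h (X n)) \<longlonglongrightarrow> l" if "bounded_linear h" for h :: "quat \<Rightarrow> real"
    using bounded_linear.Cauchy[OF that X] by (simp add: Cauchy_convergent_iff convergent_def)
  obtain a b c d where lim: "(\<lambda>n. qre (X n)) \<longlonglongrightarrow> a" "(\<lambda>n. qi (X n)) \<longlonglongrightarrow> b"
    "(\<lambda>n. qj (X n)) \<longlonglongrightarrow> c" "(\<lambda>n. qk (X n)) \<longlonglongrightarrow> d"
    using conv[OF bounded_linear_qre] conv[OF bounded_linear_qi] conv[OF bounded_linear_qj]
      conv[OF bounded_linear_qk] by blast
  have "(\<lambda>n. norm (X n - Quat a b c d)) \<longlonglongrightarrow> 0"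
  proof (rule tendsto_sandwich[OF _ _ tendsto_const])
    show "(\<lambda>n. \<bar>qre (X n) - a\<bar> + \<bar>qi (X n) - b\<bar> + \<bar>qj (X n) - c\<bar> + \<bar>qk (X n) - d\<bar>) \<longlonglongrightarrow> 0"
      using lim by (auto intro!: tendsto_eq_intros)
    show "\<forall>\<^sub>F n in sequentially. norm (X n - Quat a b c d)
        \<le> \<bar>qre (X n) - a\<bar> + \<bar>qi (X n) - b\<bar> + \<bar>qj (X n) - c\<bar> + \<bar>qk (X n) - d\<bar>"
      using norm_quat_le[of "X _ - Quat a b c d"] by simp
  qed simp
  then have "X \<longlonglongrightarrow> Quat a b c d"
    by (simp add: LIM_zero_cancel tendsto_norm_zero_iff)
  then show "convergent X"
    by (auto simp: convergent_def)
qed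

section \<open>The complex slice\<close>

definition quat_of_complex :: "complex \<Rightarrow> quat" where
  "quat_of_complex z = Quat (Re z) (Im z) 0 0"

text \<open>Components of the decomposition \<open>q = F + jG\<close> with \<open>F, G\<close> in the slice; writing \<open>j\<close> on the
  left makes them linear with respect to right multiplication by the slice.\<close>

definition cpart1 :: "quat \<Rightarrow> complex" where "cpart1 q = Complex (qre q) (qi q)"

definition cpart2 :: "quat \<Rightarrow> complex" where "cpart2 q = Complex (qj q) (- qk q)"

text \<open>The quaternion a + j b; the sign of the last component comes from j i = -k.\<close>

definition quat_of_cparts :: "complex \<Rightarrow> complex \<Rightarrow> quat" where
  "quat_of_cparts a b = Quat (Re a) (Im a) (Re b) (- Im b)"

lemma quat_of_complex_simps [simp]:
  "quat_of_complex 0 = 0" "quat_of_complex 1 = 1"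
  "quat_of_complex (z + w) = quat_of_complex z + quat_of_complex w"
  "quat_of_complex (z - w) = quat_of_complex z - quat_of_complex w"
  "quat_of_complex (z * w) = quat_of_complex z * quat_of_complex w"
  "norm (quat_of_complex z) = norm z"
  by (simp_all add: quat_of_complex_def quat_eq_iff norm_quat cmod_def)

lemma quat_of_complex_power [simp]: "quat_of_complex (z ^ k) = quat_of_complex z ^ k"
  by (induction k) simp_all

lemma cpart_mult_slice [simp]:
  "cpart1 (q * quat_of_complex z) = cpart1 q * z"
  "cpart2 (q * quat_of_complex z) = cpart2 q * z"
  by (simp_all add: cpart1_def cpart2_def quat_of_complex_def complex_eq_iff)

lemma cpart_mult_slice_power [simp]:
  "cpart1 (q * quat_of_complex z ^ k) = cpart1 q * z ^ k"
  "cpart2 (q * quat_of_complex z ^ k) = cpart2 q * z ^ k"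
  by (simp_all flip: quat_of_complex_power)

lemma cpart_of_cparts [simp]:
  "cpart1 (quat_of_cparts a b) = a" "cpart2 (quat_of_cparts a b) = b"
  by (simp_all add: cpart1_def cpart2_def quat_of_cparts_def)

lemma quat_eq_cparts_iff: "p = q \<longleftrightarrow> cpart1 p = cpart1 q \<and> cpart2 p = cpart2 q"
  by (auto simp: cpart1_def cpart2_def quat_eq_iff)

lemma norm_cparts: "(norm q)\<^sup>2 = (norm (cpart1 q))\<^sup>2 + (norm (cpart2 q))\<^sup>2"
  by (simp add: norm_quat_power2 cpart1_def cpart2_def cmod_power2)

lemma cpart1_le: "norm (cpart1 q) \<le> norm q" and cpart2_le: "norm (cpart2 q) \<le> norm q"
  by (rule power2_le_imp_le; simp add: norm_cparts)+

lemma bounded_linear_cpart1: "bounded_linear cpart1"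
  by (rule bounded_linear_intro[where K = 1])
    (simp_all add: cpart1_def complex_eq_iff cpart1_le[unfolded cpart1_def])

lemma bounded_linear_cpart2: "bounded_linear cpart2"
  by (rule bounded_linear_intro[where K = 1])
    (simp_all add: cpart2_def complex_eq_iff cpart2_le[unfolded cpart2_def])

lemma norm_quat_of_cparts_le: "norm (quat_of_cparts a b) \<le> norm a + norm b"
proof (rule power2_le_imp_le)
  have "(norm (quat_of_cparts a b))\<^sup>2 = (norm a)\<^sup>2 + (norm b)\<^sup>2"
    using norm_cparts[of "quat_of_cparts a b"] by simp
  then show "(norm (quat_of_cparts a b))\<^sup>2 \<le> (norm a + norm b)\<^sup>2"
    unfolding power2_sum by simp
qed simp

section \<open>The Pick inequality\<close>

lemma summable_conjugated_power:
  fixes a b c :: quat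
  assumes "norm a < 1" "norm b < 1"
  shows "summable (\<lambda>k. a ^ k * c * b ^ k)"
proof (rule summable_comparison_test)
  show "\<exists>N. \<forall>k\<ge>N. norm (a ^ k * c * b ^ k) \<le> norm c * (norm a * norm b) ^ k"
    by (simp add: norm_mult norm_power power_mult_distrib)
  have "norm a * norm b < 1"
    using mult_strict_mono[of "norm a" 1 "norm b" 1] assms by simp
  then show "summable (\<lambda>k. norm c * (norm a * norm b) ^ k)"
    by (intro summable_mult summable_geometric) (simp add: abs_mult)
qed

text \<open>Expanding the squares gives double sums over i, j of the terms \<open>t c i j k\<close>,
  with \<open>c = 1\<close> for \<open>u\<close> and
  \<open>c = qcnj (f (zs ! i)) * f (zs ! j)\<close> for \<open>v\<close>. Their difference, summed
  over k, is the quadratic form of the dual Pick matrix at \<open>x\<close>.\<close>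

lemma dual_pick_inequality:
  fixes x :: "nat \<Rightarrow> quat"
  assumes psd: "qpsd (length zs) (dual_pick f zs)" and zs: "set zs \<subseteq> qball"
  defines "u \<equiv> \<lambda>k. \<Sum>j<length zs. (zs ! j) ^ k * x j"
    and "v \<equiv> \<lambda>k. \<Sum>j<length zs. f (zs ! j) * (zs ! j) ^ k * x j"
  shows "summable (\<lambda>k. (norm (u k))\<^sup>2)" "summable (\<lambda>k. (norm (v k))\<^sup>2)"
    "(\<Sum>k. (norm (v k))\<^sup>2) \<le> (\<Sum>k. (norm (u k))\<^sup>2)"
proof -
  define n where "n = length zs"
  define t where "t c i j k = qcnj (x i) * (qcnj (zs ! i) ^ k * c * (zs ! j) ^ k) * x j" for c i j k
  have t: "t c i j sums (qcnj (x i) * (\<Sum>k. qcnj (zs ! i) ^ k * c * (zs ! j) ^ k) * x j)"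
    if "i < n" "j < n" for c i j
  proof -
    have "norm (zs ! i) < 1" "norm (zs ! j) < 1"
      using that zs nth_mem unfolding n_def qball_def by blast+
    then show ?thesis
      unfolding t_def by (intro sums_mult sums_mult2 summable_sums summable_conjugated_power) auto
  qed
  have norm2: "qre (qcnj y * y) = (norm y)\<^sup>2" for y
    by (simp add: qcnj_mult_quat del: quat_mult_simps)
  have u: "(norm (u k))\<^sup>2 = qre (\<Sum>i<n. \<Sum>j<n. t 1 i j k)" for k
    unfolding norm2[symmetric]
    by (simp add: u_def n_def t_def qcnj_sum sum_product qcnj_power mult.assoc del: quat_mult_simps)
  have v: "(norm (v k))\<^sup>2 = qre (\<Sum>i<n. \<Sum>j<n. t (qcnj (f (zs ! i)) * f (zs ! j)) i j k)" for k
    unfolding norm2[symmetric]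
    by (simp add: v_def n_def t_def qcnj_sum sum_product qcnj_power mult.assoc del: quat_mult_simps)
  show su: "summable (\<lambda>k. (norm (u k))\<^sup>2)"
    unfolding u by (intro bounded_linear.summable[OF bounded_linear_qre] summable_sum)
      (use t in \<open>auto intro: sums_summable\<close>)
  show sv: "summable (\<lambda>k. (norm (v k))\<^sup>2)"
    unfolding v by (intro bounded_linear.summable[OF bounded_linear_qre] summable_sum)
      (use t in \<open>auto intro: sums_summable\<close>)
  have "(norm (u k))\<^sup>2 - (norm (v k))\<^sup>2
      = qre (\<Sum>i<n. \<Sum>j<n. t (1 - qcnj (f (zs ! i)) * f (zs ! j)) i j k)" for k
    \<comment> \<open>\<open>quat_simps(13)\<close> is the rule for \<open>qre (x - y)\<close>; read
      backwards it merges the two real parts.\<close>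
    unfolding u v quat_simps(13)[symmetric] sum_subtractf[symmetric] t_def
    by (simp add: algebra_simps del: quat_mult_simps)
  moreover have "(\<lambda>k. qre (\<Sum>i<n. \<Sum>j<n. t (1 - qcnj (f (zs ! i)) * f (zs ! j)) i j k)) sums
      qre (\<Sum>i<n. \<Sum>j<n. qcnj (x i) * dual_pick f zs i j * x j)"
    unfolding dual_pick_def
    by (intro bounded_linear.sums[OF bounded_linear_qre] sums_sum) (use t in auto)
  ultimately have "(\<lambda>k. (norm (u k))\<^sup>2 - (norm (v k))\<^sup>2) sums
      qre (\<Sum>i<n. \<Sum>j<n. qcnj (x i) * dual_pick f zs i j * x j)"
    by simp
  moreover have "qre (\<Sum>i<n. \<Sum>j<n. qcnj (x i) * dual_pick f zs i j * x j) \<ge> 0"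
    using psd unfolding qpsd_def qnonneg_def n_def by blast
  ultimately have "0 \<le> (\<Sum>k. (norm (u k))\<^sup>2 - (norm (v k))\<^sup>2)"
    by (simp add: sums_iff)
  then show "(\<Sum>k. (norm (v k))\<^sup>2) \<le> (\<Sum>k. (norm (u k))\<^sup>2)"
    using suminf_diff[OF su sv] by simp
qed

locale dual_pick3 =
  fixes f :: "quat \<Rightarrow> quat"
  assumes psd: "\<And>z1 z2 z3. z1 \<in> qball \<Longrightarrow> z2 \<in> qball \<Longrightarrow> z3 \<in> qball \<Longrightarrow> qpsd 3 (dual_pick f [z1, z2, z3])"
begin

text \<open>Of the left-hand series in \<open>dual_pick_inequality\<close> only the term k = 0 is
  kept; the others are nonnegative.\<close>

lemma three_point:
  assumes "z1 \<in> qball" "z2 \<in> qball" "z3 \<in> qball"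
  shows "(norm (f z1 * x1 + f z2 * x2 + f z3 * x3))\<^sup>2 \<le> (\<Sum>k. (norm (z1 ^ k * x1 + z2 ^ k * x2 + z3 ^ k * x3))\<^sup>2)"
proof -
  define x where "x = (\<lambda>j::nat. if j = 0 then x1 else if j = 1 then x2 else x3)"
  have *: "(\<Sum>j<length [z1, z2, z3]. h j) = h 0 + h 1 + h 2" for h :: "nat \<Rightarrow> quat"
    by (simp add: eval_nat_numeral)
  have "qpsd (length [z1, z2, z3]) (dual_pick f [z1, z2, z3])"
    using psd[OF assms] by (simp add: eval_nat_numeral)
  note ineq = dual_pick_inequality[OF this, of x, unfolded *]
  have "(norm (f z1 * x1 + f z2 * x2 + f z3 * x3))\<^sup>2
      = (\<Sum>k<1. (norm (f z1 * z1 ^ k * x1 + f z2 * z2 ^ k * x2 + f z3 * z3 ^ k * x3))\<^sup>2)"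
    by simp
  also have "\<dots> \<le> (\<Sum>k. (norm (f z1 * z1 ^ k * x1 + f z2 * z2 ^ k * x2 + f z3 * z3 ^ k * x3))\<^sup>2)"
    by (rule sum_le_suminf) (use ineq(2) assms in \<open>auto simp: x_def\<close>)
  also have "\<dots> \<le> (\<Sum>k. (norm (z1 ^ k * x1 + z2 ^ k * x2 + z3 ^ k * x3))\<^sup>2)"
    using ineq(3) assms by (simp add: x_def)
  finally show ?thesis .
qed

lemma norm_le_1:
  assumes "z \<in> qball"
  shows "norm (f z) \<le> 1"
proof -
  \<comment> \<open>Weights 1, 0, 0 at the triple node z make both series multiples of the sum of
    |z|^(2k), which is at least 1 and can be cancelled.\<close>
  define x :: "nat \<Rightarrow> quat" where "x = (\<lambda>j. if j = 0 then 1 else 0)"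
  have *: "(\<Sum>j<length [z, z, z]. h j) = h 0 + h 1 + h 2" for h :: "nat \<Rightarrow> quat"
    by (simp add: eval_nat_numeral)
  have "qpsd (length [z, z, z]) (dual_pick f [z, z, z])"
    using psd[OF assms assms assms] by (simp add: eval_nat_numeral)
  note ineq = dual_pick_inequality[OF this, of x, unfolded *]
  have su: "summable (\<lambda>k. (norm (z ^ k))\<^sup>2)"
    using ineq(1) assms by (simp add: x_def)
  have "(\<Sum>k. (norm (f z))\<^sup>2 * (norm (z ^ k))\<^sup>2) \<le> (\<Sum>k. (norm (z ^ k))\<^sup>2)"
    using ineq(3) assms by (simp add: x_def norm_mult power_mult_distrib)
  then have "(norm (f z))\<^sup>2 * (\<Sum>k. (norm (z ^ k))\<^sup>2) \<le> 1 * (\<Sum>k. (norm (z ^ k))\<^sup>2)"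
    using suminf_mult[OF su] by simp
  moreover have "(\<Sum>k<1. (norm (z ^ k))\<^sup>2) \<le> (\<Sum>k. (norm (z ^ k))\<^sup>2)"
    by (rule sum_le_suminf) (use su in auto)
  ultimately have "(norm (f z))\<^sup>2 \<le> 1"
    by (simp add: mult_le_cancel_right)
  then show ?thesis
    by (simp add: power_le_one_iff abs_square_le_1)
qed

end

section \<open>Bounded second divided differences force analyticity\<close>

text \<open>Second divided difference h[a, b, c] in Lagrange form: the explicit weights on the
  values of h are what the Pick inequality takes as input.\<close>

definition divdiff2 :: "(complex \<Rightarrow> complex) \<Rightarrow> complex \<Rightarrow> complex \<Rightarrow> complex \<Rightarrow> complex" where
  "divdiff2 h a b c = h a / ((a - b) * (a - c)) + h b / ((b - a) * (b - c)) + h c / ((c - a) * (c - b))"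

lemma divdiff2_eq:
  assumes "a \<noteq> b" "a \<noteq> c" "b \<noteq> c"
  shows "(b - c) * divdiff2 h a b c = (h b - h a) / (b - a) - (h c - h a) / (c - a)"
  using assms unfolding divdiff2_def by (simp add: divide_simps) (simp add: algebra_simps)

text \<open>By \<open>divdiff2_eq\<close> the difference quotient at a is Lipschitz on the punctured
  set, so it extends continuously to a, and its limit there is the derivative.\<close>

lemma field_differentiable_if_divdiff2_bounded:
  assumes S: "open S" "a \<in> S"
    and bound: "\<And>b c. b \<in> S \<Longrightarrow> c \<in> S \<Longrightarrow> a \<noteq> b \<Longrightarrow> a \<noteq> c \<Longrightarrow> b \<noteq> c \<Longrightarrow> norm (divdiff2 h a b c) \<le> C"
  shows "h field_differentiable at a"
proof -
  define q where "q b = (h b - h a) / (b - a)" for b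
  \<comment> \<open>The constant \<open>\<bar>C\<bar> + 1\<close> is strictly positive whatever
    \<open>C\<close> is, so e can be divided by it below.\<close>
  have lip: "norm (q b - q c) \<le> (\<bar>C\<bar> + 1) * norm (b - c)" if "b \<in> S - {a}" "c \<in> S - {a}" for b c
  proof (cases "b = c")
    case False
    have "norm (q b - q c) = norm (b - c) * norm (divdiff2 h a b c)"
      using that False unfolding q_def norm_mult[symmetric] by (subst divdiff2_eq) auto
    also have "\<dots> \<le> norm (b - c) * (\<bar>C\<bar> + 1)"
      using bound[of b c] that False by (intro mult_left_mono) auto
    finally show ?thesis by (simp add: mult.commute)
  qed simp
  have "uniformly_continuous_on (S - {a}) q"
    unfolding uniformly_continuous_on_def
  proof (intro allI impI)
    fix e :: real assume e: "e > 0"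
    show "\<exists>d>0. \<forall>x\<in>S - {a}. \<forall>x'\<in>S - {a}. dist x' x < d \<longrightarrow> dist (q x') (q x) < e"
    proof (intro exI[of _ "e / (\<bar>C\<bar> + 1)"] conjI ballI impI)
      fix x x' assume *: "x \<in> S - {a}" "x' \<in> S - {a}" "dist x' x < e / (\<bar>C\<bar> + 1)"
      have "dist (q x') (q x) \<le> (\<bar>C\<bar> + 1) * dist x' x"
        using lip[OF *(2,1)] by (simp add: dist_norm)
      also have "\<dots> < e"
        using *(3) by (simp add: field_simps)
      finally show "dist (q x') (q x) < e" .
    qed (use e in simp)
  qed
  moreover have "a \<in> closure (S - {a})"
    using S by (simp add: islimpt_in_closure[symmetric] interior_limit_point interior_open)
  ultimately obtain l where "(q \<longlongrightarrow> l) (at a within S - {a})"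
    by (rule uniformly_continuous_on_extension_at_closure)
  then have "(q \<longlongrightarrow> l) (at a)"
    using S by (metis at_within_open at_within_def Diff_idemp)
  then have "(h has_field_derivative l) (at a)"
    by (simp add: has_field_derivative_iff q_def[abs_def])
  then show ?thesis
    by (auto simp: field_differentiable_def)
qed

text \<open>After factoring out b - c, there remain k monomials of degree k - 1. Writing
  \<open>r ^ k / r\<close> avoids truncated subtraction; at k = 0 the factor k vanishes.\<close>

lemma norm_power_diff_le:
  fixes b c :: complex
  assumes "norm b \<le> r" "norm c \<le> r" "0 < r"
  shows "norm (b ^ k - c ^ k) \<le> norm (b - c) * (k * (r ^ k / r))"
proof -
  have "norm (\<Sum>i<k. c ^ (k - Suc i) * b ^ i) \<le> (\<Sum>i<k. r ^ k / r)"
  proof (rule sum_norm_le)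
    fix i assume i: "i \<in> {..<k}"
    have "norm (c ^ (k - Suc i) * b ^ i) \<le> r ^ (k - Suc i) * r ^ i"
      unfolding norm_mult norm_power using assms by (intro mult_mono power_mono) auto
    also have "\<dots> = r ^ k / r"
      using i assms power_Suc[of r "k - Suc i + i"] by (simp add: field_simps flip: power_add)
    finally show "norm (c ^ (k - Suc i) * b ^ i) \<le> r ^ k / r" .
  qed
  then show ?thesis
    unfolding power_diff_sumr2 norm_mult by (intro mult_left_mono) auto
qed

text \<open>Both difference quotients of z^k expand in powers of a, so their difference consists of
  k terms a^(k-1-i) (b^i - c^i). Each is at most |b - c| k r^(k-2), and |b - c| cancels.\<close>

lemma norm_divdiff2_power_le:
  assumes "norm a \<le> r" "norm b \<le> r" "norm c \<le> r" "0 < r" "a \<noteq> b" "a \<noteq> c" "b \<noteq> c"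
  shows "norm (divdiff2 (\<lambda>z. z ^ k) a b c) \<le> (real k)\<^sup>2 * r ^ k / r\<^sup>2"
proof -
  have "(b ^ k - a ^ k) / (b - a) - (c ^ k - a ^ k) / (c - a) = (\<Sum>i<k. a ^ (k - Suc i) * (b ^ i - c ^ i))"
    using assms by (simp add: power_diff_sumr2[of b k a] power_diff_sumr2[of c k a] sum_subtractf right_diff_distrib)
  then have "norm (b - c) * norm (divdiff2 (\<lambda>z. z ^ k) a b c) = norm (\<Sum>i<k. a ^ (k - Suc i) * (b ^ i - c ^ i))"
    using assms by (simp add: norm_mult[symmetric] divdiff2_eq)
  also have "\<dots> \<le> (\<Sum>i<k. norm (b - c) * (k * r ^ k / r\<^sup>2))"
  proof (rule sum_norm_le)
    fix i assume i: "i \<in> {..<k}"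
    have "norm (a ^ (k - Suc i) * (b ^ i - c ^ i)) \<le> r ^ (k - Suc i) * (norm (b - c) * (i * (r ^ i / r)))"
      unfolding norm_mult[of "a ^ _"] norm_power using assms
      by (intro mult_mono power_mono norm_power_diff_le) auto
    also have "\<dots> \<le> r ^ (k - Suc i) * (norm (b - c) * (k * (r ^ i / r)))"
      using i assms by (intro mult_left_mono mult_right_mono) auto
    also have "\<dots> = norm (b - c) * (k * (r ^ (k - Suc i) * r ^ i / r))"
      by simp
    also have "r ^ (k - Suc i) * r ^ i = r ^ k / r"
      using i assms power_Suc[of r "k - Suc i + i"] by (simp add: field_simps flip: power_add)
    finally show "norm (a ^ (k - Suc i) * (b ^ i - c ^ i)) \<le> norm (b - c) * (k * r ^ k / r\<^sup>2)"
      by (simp add: power2_eq_square)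
  qed
  also have "\<dots> = norm (b - c) * ((real k)\<^sup>2 * r ^ k / r\<^sup>2)"
    by (simp add: power2_eq_square)
  finally show ?thesis
    using assms(7) by (subst (asm) mult_le_cancel_left_pos) simp_all
qed

lemma summable_divdiff2_bound:
  assumes "0 < r" "r < 1"
  shows "summable (\<lambda>k. ((real k)\<^sup>2 * r ^ k / r\<^sup>2)\<^sup>2)"
proof (rule summable_comparison_test_bigo)
  show "summable (\<lambda>k. norm (r ^ k))"
    using assms by (simp add: summable_geometric)
  show "(\<lambda>k. ((real k)\<^sup>2 * r ^ k / r\<^sup>2)\<^sup>2) \<in> O(\<lambda>k. r ^ k)"
    using assms by real_asymp
qed

section \<open>Power series expansion\<close>

lemma summable_two_sided:
  fixes g :: "nat \<Rightarrow> quat"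
  assumes "summable (\<lambda>k. norm (g k) * norm z ^ k)"
  shows "summable (\<lambda>k. g k * q * z ^ k)"
proof (rule summable_norm_cancel)
  have "summable (\<lambda>k. norm q * (norm (g k) * norm z ^ k))"
    using assms by (rule summable_mult)
  then show "summable (\<lambda>k. norm (g k * q * z ^ k))"
    by (simp add: norm_mult norm_power mult_ac)
qed

context dual_pick3
begin

text \<open>With the weights of the divided difference, the right-hand side of
  \<open>three_point\<close> is the sum of the squared divided differences of the powers z^k. On the
  left, \<open>cpart1\<close> and \<open>cpart2\<close> commute with right multiplication by the
  slice, so the components of y are the divided differences to be bounded.\<close>

lemma divdiff2_bound:
  assumes r: "0 < r" "r < 1" and *: "norm a \<le> r" "norm b \<le> r" "norm c \<le> r" "a \<noteq> b" "a \<noteq> c" "b \<noteq> c"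
  defines "C \<equiv> sqrt (\<Sum>k. ((real k)\<^sup>2 * r ^ k / r\<^sup>2)\<^sup>2)"
  shows "norm (divdiff2 (\<lambda>z. cpart1 (f (quat_of_complex z))) a b c) \<le> C"
    "norm (divdiff2 (\<lambda>z. cpart2 (f (quat_of_complex z))) a b c) \<le> C"
proof -
  let ?E = quat_of_complex
  define x1 x2 x3 where x: "x1 = 1 / ((a - b) * (a - c))" "x2 = 1 / ((b - a) * (b - c))"
    "x3 = 1 / ((c - a) * (c - b))"
  define y where "y = f (?E a) * ?E x1 + f (?E b) * ?E x2 + f (?E c) * ?E x3"
  have dd: "divdiff2 h a b c = h a * x1 + h b * x2 + h c * x3" for h
    by (simp add: divdiff2_def x)
  have B: "norm (?E a ^ k * ?E x1 + ?E b ^ k * ?E x2 + ?E c ^ k * ?E x3) \<le> (real k)\<^sup>2 * r ^ k / r\<^sup>2" for k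
    using norm_divdiff2_power_le[OF *(1-3) r(1) *(4-6), of k]
    unfolding dd by (simp flip: quat_of_complex_simps quat_of_complex_power)
  have "(norm y)\<^sup>2 \<le> (\<Sum>k. (norm (?E a ^ k * ?E x1 + ?E b ^ k * ?E x2 + ?E c ^ k * ?E x3))\<^sup>2)"
    unfolding y_def using * r by (intro three_point) (auto simp: qball_def)
  also have "\<dots> \<le> (\<Sum>k. ((real k)\<^sup>2 * r ^ k / r\<^sup>2)\<^sup>2)"
  proof (rule suminf_le)
    show "summable (\<lambda>k. (norm (?E a ^ k * ?E x1 + ?E b ^ k * ?E x2 + ?E c ^ k * ?E x3))\<^sup>2)"
      using B by (intro summable_comparison_test'[OF summable_divdiff2_bound[OF r]]) (auto intro: power_mono)
  qed (use B r summable_divdiff2_bound in \<open>auto intro: power_mono\<close>)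
  finally have y: "norm y \<le> C"
    unfolding C_def by (rule real_le_rsqrt)
  have "divdiff2 (\<lambda>z. cpart1 (f (?E z))) a b c = cpart1 y"
    unfolding dd y_def
    by (simp add: linear_add[OF bounded_linear.linear[OF bounded_linear_cpart1]])
  then show "norm (divdiff2 (\<lambda>z. cpart1 (f (?E z))) a b c) \<le> C"
    using cpart1_le[of y] y by simp
  have "divdiff2 (\<lambda>z. cpart2 (f (?E z))) a b c = cpart2 y"
    unfolding dd y_def
    by (simp add: linear_add[OF bounded_linear.linear[OF bounded_linear_cpart2]])
  then show "norm (divdiff2 (\<lambda>z. cpart2 (f (?E z))) a b c) \<le> C"
    using cpart2_le[of y] y by simp
qed

lemma holomorphic_cpart:
  "(\<lambda>z. cpart1 (f (quat_of_complex z))) holomorphic_on ball 0 1"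
  "(\<lambda>z. cpart2 (f (quat_of_complex z))) holomorphic_on ball 0 1"
proof -
  have "(\<lambda>z. cpart1 (f (quat_of_complex z))) field_differentiable at a \<and>
    (\<lambda>z. cpart2 (f (quat_of_complex z))) field_differentiable at a" if "a \<in> ball 0 1" for a
  proof -
    \<comment> \<open>Any radius strictly between |a| and 1 gives a bound uniform on a neighbourhood
      of a.\<close>
    define r where "r = (1 + norm a) / 2"
    have r: "0 < r" "r < 1" "norm a < r"
      using that by (auto simp: r_def field_simps add_pos_nonneg)
    show ?thesis
      using divdiff2_bound[OF r(1,2)] r
      by (intro conjI field_differentiable_if_divdiff2_bounded[of "ball 0 r" _ _
            "sqrt (\<Sum>k. ((real k)\<^sup>2 * r ^ k / r\<^sup>2)\<^sup>2)"]) auto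
  qed
  then show "(\<lambda>z. cpart1 (f (quat_of_complex z))) holomorphic_on ball 0 1"
    "(\<lambda>z. cpart2 (f (quat_of_complex z))) holomorphic_on ball 0 1"
    by (auto simp: holomorphic_on_open field_differentiable_def)
qed

text \<open>The Taylor coefficients of the two holomorphic components are glued into g_k = a_k + j
  b_k, which stand to the left of the powers as right evaluation requires.\<close>

lemma power_series_on_slice:
  obtains g :: "nat \<Rightarrow> quat" where
    "\<And>r. 0 \<le> r \<Longrightarrow> r < 1 \<Longrightarrow> summable (\<lambda>k. norm (g k) * r ^ k)"
    "\<And>z. norm z < 1 \<Longrightarrow> eval_r g (quat_of_complex z) = f (quat_of_complex z)"
proof -
  define h1 h2 where h: "h1 = (\<lambda>z. cpart1 (f (quat_of_complex z)))" "h2 = (\<lambda>z. cpart2 (f (quat_of_complex z)))"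
  define a b where ab: "a k = (deriv ^^ k) h1 0 / fact k" "b k = (deriv ^^ k) h2 0 / fact k" for k
  define g where "g k = quat_of_cparts (a k) (b k)" for k
  have sums: "(\<lambda>k. a k * z ^ k) sums h1 z" "(\<lambda>k. b k * z ^ k) sums h2 z" if "norm z < 1" for z
    using holomorphic_power_series[of h1 0 1 z] holomorphic_power_series[of h2 0 1 z] holomorphic_cpart that
    by (auto simp: h ab)
  have abs: "summable (\<lambda>k. norm (g k) * r ^ k)" if r: "0 \<le> r" "r < 1" for r
  proof -
    \<comment> \<open>Convergence at the larger radius s yields absolute convergence at r.\<close>
    define s where "s = (r + 1) / 2"
    have s: "r < s" "s < 1" "0 < s" using r by (auto simp: s_def)
    have "summable (\<lambda>k. norm (a k * of_real r ^ k))" "summable (\<lambda>k. norm (b k * of_real r ^ k))"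
      using powser_insidea[of a "of_real s" "of_real r"] powser_insidea[of b "of_real s" "of_real r"]
        sums[of "of_real s"] s r by (auto simp: sums_iff)
    then have "summable (\<lambda>k. norm (a k) * r ^ k + norm (b k) * r ^ k)"
      using r by (intro summable_add) (auto simp: norm_mult norm_power)
    then show ?thesis
    proof (rule summable_comparison_test')
      show "norm (norm (g k) * r ^ k) \<le> norm (a k) * r ^ k + norm (b k) * r ^ k" for k
        using mult_right_mono[OF norm_quat_of_cparts_le[of "a k" "b k"], of "r ^ k"] r
        by (simp add: g_def distrib_right)
    qed
  qed
  have "eval_r g (quat_of_complex z) = f (quat_of_complex z)" if z: "norm z < 1" for z
  proof -
    have S: "summable (\<lambda>k. g k * quat_of_complex z ^ k)"
      using summable_two_sided[of g "quat_of_complex z" 1] abs[of "norm z"] z by simp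
    have "cpart1 (eval_r g (quat_of_complex z)) = h1 z"
      unfolding eval_r_def bounded_linear.suminf[OF bounded_linear_cpart1 S]
      using sums(1)[OF z] by (simp add: g_def sums_iff)
    moreover have "cpart2 (eval_r g (quat_of_complex z)) = h2 z"
      unfolding eval_r_def bounded_linear.suminf[OF bounded_linear_cpart2 S]
      using sums(2)[OF z] by (simp add: g_def sums_iff)
    ultimately show ?thesis
      by (simp add: quat_eq_cparts_iff h)
  qed
  with abs show ?thesis by (rule that)
qed

end

section \<open>From the slice to the ball\<close>

lemma quat_square: "t * t = (2 * qre t) *\<^sub>R t - (norm t)\<^sup>2 *\<^sub>R (1::quat)"
  unfolding norm_quat_power2 by (simp add: quat_eq_iff power2_eq_square)

text \<open>All quaternions with the same real part and modulus satisfy the same real quadratic equation, so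
  the power sequences of any three of them are right linearly dependent.\<close>

lemma sphere_dependence:
  obtains z :: complex and x1 x2 :: quat where "norm z = norm a"
    "\<And>k. quat_of_complex z ^ k * x1 + quat_of_complex (cnj z) ^ k * x2 + a ^ k * 1 = 0"
proof -
  define y where "y = sqrt ((qi a)\<^sup>2 + (qj a)\<^sup>2 + (qk a)\<^sup>2)"
  \<comment> \<open>z and \<open>cnj z\<close> are the points where the sphere of a (same real part,
    same modulus) meets the slice.\<close>
  define z where "z = Complex (qre a) y"
  have nz: "norm z = norm a"
    by (simp add: z_def y_def cmod_def norm_quat add.assoc)
  show ?thesis
  proof (cases "y = 0")
    case True
    \<comment> \<open>For real a the sphere is a single point and p - q below would be 0; here a =
      z, and the weight -1 on z suffices.\<close>
    then have "(qi a)\<^sup>2 + (qj a)\<^sup>2 + (qk a)\<^sup>2 = 0"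
      by (simp add: y_def)
    then have "qi a = 0 \<and> qj a = 0 \<and> qk a = 0"
      by (simp add: add_nonneg_eq_0_iff)
    then have "quat_of_complex z = a"
      using True by (simp add: z_def quat_of_complex_def quat_eq_iff)
    then show ?thesis
      using nz by (intro that[of z "-1" 0]) auto
  next
    case False
    define p q where pq: "p = quat_of_complex z" "q = quat_of_complex (cnj z)"
    have "p \<noteq> q"
      using False by (auto simp: pq z_def quat_of_complex_def)
    then have d: "(p - q) * (inverse (p - q) * w) = w" for w
      by (simp add: mult.assoc[symmetric])
    \<comment> \<open>Solves the cases k = 0 and k = 1: x1 + x2 = -1 and p x1 + q x2 = -a.\<close>
    define x1 where "x1 = inverse (p - q) * (q - a)"
    define u where "u k = p ^ k * x1 + q ^ k * (- 1 - x1) + a ^ k" for k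
    \<comment> \<open>The common quadratic equation makes all three power sequences satisfy one
      linear recurrence with real coefficients; hence so does u, which therefore vanishes once its
      first two terms do.\<close>
    have rec: "t ^ Suc (Suc k) = (2 * qre a) *\<^sub>R t ^ Suc k - (norm a)\<^sup>2 *\<^sub>R t ^ k" if "t \<in> {p, q, a}" for t k
    proof -
      have t: "qre t = qre a" "norm t = norm a"
        using that nz by (auto simp: pq) (auto simp: z_def quat_of_complex_def)
      have "t ^ Suc (Suc k) = t ^ k * (t * t)"
        using power_add[of t k 2] by (simp add: power2_eq_square)
      also have "\<dots> = (2 * qre a) *\<^sub>R (t ^ k * t) - (norm a)\<^sup>2 *\<^sub>R t ^ k"
        unfolding quat_square[of t] t by (simp add: right_diff_distrib)
      finally show ?thesis
        by (simp add: power_commutes)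
    qed
    have "u k = 0 \<and> u (Suc k) = 0" for k
    proof (induction k)
      case 0
      have "u (Suc 0) = (p - q) * x1 - (q - a)"
        by (simp add: u_def algebra_simps)
      then show ?case
        by (simp add: u_def x1_def d)
    next
      case (Suc k)
      have "u (Suc (Suc k)) = (2 * qre a) *\<^sub>R u (Suc k) - (norm a)\<^sup>2 *\<^sub>R u k"
        unfolding u_def using rec[of p k] rec[of q k] rec[of a k]
        by (simp only: insert_iff simp_thms) (simp add: algebra_simps del: power_Suc)
      with Suc show ?case by simp
    qed
    then show ?thesis
      using nz by (intro that[of z x1 "- 1 - x1"]) (auto simp: u_def pq)
  qed
qed

lemma eval_r_sums:
  assumes "summable (\<lambda>k. norm (g k) * norm z ^ k)"
  shows "(\<lambda>k. g k * z ^ k) sums eval_r g z"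
  using summable_sums[OF summable_two_sided[OF assms, of 1]] by (simp add: eval_r_def)

text \<open>The weights from \<open>sphere_dependence\<close> annihilate the right-hand side of
  \<open>three_point\<close>, and also each term of the weighted series of g. So f a and
  \<open>eval_r g a\<close> are the same combination of the values at p and q, which lie in the
  slice.\<close>

lemma (in dual_pick3) eval_r_eq_on_ball:
  assumes abs: "\<And>r. 0 \<le> r \<Longrightarrow> r < 1 \<Longrightarrow> summable (\<lambda>k. norm (g k) * r ^ k)"
    and slice: "\<And>z. norm z < 1 \<Longrightarrow> eval_r g (quat_of_complex z) = f (quat_of_complex z)"
    and a: "a \<in> qball"
  shows "eval_r g a = f a"
proof -
  obtain z x1 x2 where z: "norm z = norm a"
    and dep: "\<And>k. quat_of_complex z ^ k * x1 + quat_of_complex (cnj z) ^ k * x2 + a ^ k * 1 = 0"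
    using sphere_dependence[of a] by metis
  define p q where pq: "p = quat_of_complex z" "q = quat_of_complex (cnj z)"
  have norms: "norm a < 1" "norm p = norm a" "norm q = norm a"
    using a z by (auto simp: pq qball_def)
  have "(norm (f p * x1 + f q * x2 + f a * 1))\<^sup>2 \<le> 0"
    using three_point[of p q a x1 x2 1] norms dep by (simp add: qball_def pq)
  then have "f p * x1 + f q * x2 + f a = 0"
    by simp
  moreover have "(\<lambda>k. g k * p ^ k * x1 + g k * q ^ k * x2 + g k * a ^ k) sums
      (eval_r g p * x1 + eval_r g q * x2 + eval_r g a)"
    using norms abs[of "norm a"] by (intro sums_add sums_mult2 eval_r_sums) auto
  then have "(\<lambda>k. g k * (p ^ k * x1 + q ^ k * x2 + a ^ k * 1)) sums
      (eval_r g p * x1 + eval_r g q * x2 + eval_r g a)"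
    by (simp add: algebra_simps)
  then have "eval_r g p * x1 + eval_r g q * x2 + eval_r g a = 0"
    using dep by (simp add: pq sums_iff)
  moreover have "eval_r g p = f p" "eval_r g q = f q"
    using slice[of z] slice[of "cnj z"] norms by (auto simp: pq)
  ultimately have "f p * x1 + f q * x2 + eval_r g a = f p * x1 + f q * x2 + f a"
    by simp
  then show ?thesis by simp
qed

section \<open>Contractivity of the Toeplitz matrices\<close>

text \<open>Orthogonality of characters: the summands are powers of w with w^M = 1, and w differs
  from 1 when m and l do, so the geometric sum vanishes.\<close>

lemma sum_root_of_unity_powers:
  fixes m l M :: nat
  assumes "m < M" "l < M"
  shows "(\<Sum>s<M. cis (2 * pi * s / M) ^ m * cnj (cis (2 * pi * s / M) ^ l)) = (if m = l then of_nat M else 0)"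
proof -
  define w where "w = cis (2 * pi * (real m - real l) / M)"
  have w: "cis (2 * pi * s / M) ^ m * cnj (cis (2 * pi * s / M) ^ l) = w ^ s" for s :: nat
    unfolding Complex.DeMoivre cis_cnj cis_mult w_def by (rule arg_cong[of _ _ cis]) (simp add: right_diff_distrib left_diff_distrib diff_divide_distrib mult_ac)
  show ?thesis
  proof (cases "m = l")
    case True
    then show ?thesis unfolding w by (simp add: w_def)
  next
    case False
    have "w \<noteq> 1"
    proof
      assume "w = 1"
      then have "cos (2 * pi * (real m - real l) / M) = 1"
        by (simp add: w_def complex_eq_iff)
      then obtain k :: int where "2 * pi * (real m - real l) / M = k * 2 * pi"
        by (auto simp: cos_one_2pi_int)
      then have "(2 * pi) * (real m - real l) = (2 * pi) * (k * M)"
        using assms by (simp add: divide_eq_eq mult_ac)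
      then have "real m - real l = k * M"
        by (subst (asm) mult_cancel_left) simp
      then have k: "int m - int l = k * int M"
        by (metis of_int_diff of_int_eq_iff of_int_mult of_int_of_nat_eq)
      \<comment> \<open>Since |m - l| < M, the multiple k M of M can only be 0.\<close>
      have "k = 0"
      proof (rule ccontr)
        assume "k \<noteq> 0"
        then have "1 * int M \<le> \<bar>k\<bar> * int M"
          by (intro mult_right_mono) auto
        also have "\<dots> = \<bar>int m - int l\<bar>"
          by (simp add: k abs_mult)
        finally show False using assms by linarith
      qed
      with k False show False by simp
    qed
    moreover have "w ^ M = 1"
    proof -
      have "M \<noteq> 0"
        using assms by simp
      then have "w ^ M = cis (2 * pi * (real_of_int (int m - int l)))"
        unfolding w_def Complex.DeMoivre by simp
      also have "\<dots> = 1"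
        by (rule cis_multiple_2pi) auto
      finally show ?thesis .
    qed
    ultimately show ?thesis
      unfolding w using False by (simp add: geometric_sum)
  qed
qed

text \<open>For polynomials of degree below M, sampling at the M-th roots of unity gives Parseval's
  identity exactly, with no integral. Expand the squares and apply orthogonality.\<close>

lemma discrete_parseval:
  fixes c :: "nat \<Rightarrow> complex" and M :: nat
  shows "(\<Sum>s<M. (norm (\<Sum>m<M. c m * cis (2 * pi * real s / M) ^ m))\<^sup>2) = M * (\<Sum>m<M. (norm (c m))\<^sup>2)"
proof -
  define e where "e s m = cis (2 * pi * s / M) ^ m" for s m :: nat
  have "complex_of_real (\<Sum>s<M. (norm (\<Sum>m<M. c m * e s m))\<^sup>2)
      = (\<Sum>s<M. \<Sum>m<M. \<Sum>l<M. c m * cnj (c l) * (e s m * cnj (e s l)))"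
    by (simp add: complex_norm_square sum_product mult_ac del: of_real_power)
  also have "\<dots> = (\<Sum>m<M. \<Sum>l<M. c m * cnj (c l) * (\<Sum>s<M. e s m * cnj (e s l)))"
    by (subst sum.swap, rule sum.cong[OF refl], subst sum.swap) (simp add: sum_distrib_left)
  also have "\<dots> = (\<Sum>m<M. \<Sum>l<M. if m = l then c m * cnj (c m) * M else 0)"
    by (intro sum.cong refl) (use sum_root_of_unity_powers in \<open>auto simp: e_def simp del: complex_cnj_power\<close>)
  also have "\<dots> = of_real (M * (\<Sum>m<M. (norm (c m))\<^sup>2))"
    by (simp add: complex_norm_square sum_distrib_left mult_ac del: of_real_power)
  finally show ?thesis
    unfolding of_real_eq_iff e_def .
qed

lemma discrete_parseval_quat:
  fixes c :: "nat \<Rightarrow> quat" and r :: real and M n :: nat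
  assumes "n \<le> M" "0 \<le> r"
  defines "w \<equiv> \<lambda>s. quat_of_complex (r * cis (2 * pi * s / M))"
  shows "(\<Sum>s<M. (norm (\<Sum>m<n. c m * w (real s) ^ m))\<^sup>2) = M * (\<Sum>m<n. (norm (c m) * r ^ m)\<^sup>2)"
proof -
  \<comment> \<open>Padding the coefficients with zeros up to M reduces the claim to
    \<open>discrete_parseval\<close> for each of the two components.\<close>
  define d where "d m = (if m < n then c m else 0)" for m
  have 1: "(\<Sum>m<n. c m * w s ^ m) = (\<Sum>m<M. d m * w s ^ m)" for s
    using assms(1) by (intro sum.mono_neutral_cong_left) (auto simp: d_def)
  have 2: "(\<Sum>m<n. (norm (c m) * r ^ m)\<^sup>2) = (\<Sum>m<M. (norm (d m) * r ^ m)\<^sup>2)"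
    using assms(1) by (intro sum.mono_neutral_cong_left) (auto simp: d_def)
  have c1: "cpart1 (\<Sum>m<M. d m * w s ^ m) = (\<Sum>m<M. (cpart1 (d m) * r ^ m) * cis (2 * pi * s / M) ^ m)" for s
    unfolding w_def by (simp add: linear_sum[OF bounded_linear.linear[OF bounded_linear_cpart1]]
        power_mult_distrib mult_ac del: quat_of_complex_simps)
  have c2: "cpart2 (\<Sum>m<M. d m * w s ^ m) = (\<Sum>m<M. (cpart2 (d m) * r ^ m) * cis (2 * pi * s / M) ^ m)" for s
    unfolding w_def by (simp add: linear_sum[OF bounded_linear.linear[OF bounded_linear_cpart2]]
        power_mult_distrib mult_ac del: quat_of_complex_simps)
  have "(\<Sum>s<M. (norm (\<Sum>m<M. d m * w (real s) ^ m))\<^sup>2)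
      = M * (\<Sum>m<M. (norm (cpart1 (d m) * r ^ m))\<^sup>2) + M * (\<Sum>m<M. (norm (cpart2 (d m) * r ^ m))\<^sup>2)"
    unfolding norm_cparts[of "\<Sum>m<M. _ m"] c1 c2 sum.distrib discrete_parseval ..
  also have "\<dots> = M * (\<Sum>m<M. (norm (d m) * r ^ m)\<^sup>2)"
    unfolding distrib_left[symmetric] sum.distrib[symmetric]
    by (simp add: norm_mult norm_power power_mult_distrib norm_cparts distrib_right assms)
  finally show ?thesis
    unfolding 1 2 .
qed

text \<open>Conjugating \<open>z\<close> by \<open>q\<close> turns the two-sided series into a value of \<open>g\<close> at another point of
  the ball.\<close>

lemma norm_two_sided_le:
  assumes bnd: "\<And>a. a \<in> qball \<Longrightarrow> norm (eval_r g a) \<le> 1" and z: "norm z < 1"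
    and abs: "summable (\<lambda>k. norm (g k) * norm z ^ k)"
  shows "norm (\<Sum>k. g k * q * z ^ k) \<le> norm q"
proof (cases "q = 0")
  case False
  define a where "a = q * z * inverse q"
  have na: "norm a = norm z"
    using False by (simp add: a_def norm_mult norm_inverse)
  have "q * z ^ k = a ^ k * q" for k
  proof (induction k)
    case (Suc k)
    have "q * z ^ Suc k = a ^ k * (q * z)"
      using Suc by (simp add: power_Suc2 mult.assoc[symmetric] del: power_Suc)
    also have "q * z = a * q"
      using False by (simp add: a_def mult.assoc)
    finally show ?case
      by (simp add: power_Suc2 mult.assoc[symmetric] del: power_Suc)
  qed simp
  then have "(\<Sum>k. g k * q * z ^ k) = (\<Sum>k. g k * a ^ k * q)"
    by (simp add: mult.assoc)
  also have "\<dots> = eval_r g a * q"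
    using sums_mult2[OF eval_r_sums[of g a], of q] abs na by (simp add: sums_iff)
  finally show ?thesis
    using bnd[of a] na z mult_right_mono[of "norm (eval_r g a)" 1 "norm q"]
    by (simp add: qball_def norm_mult)
qed simp

text \<open>Discrete Parseval handles only polynomials, so the series is cut at N; the tail costs at
  most e |q|, with e independent of q.\<close>

lemma norm_two_sided_partial_le:
  assumes bnd: "\<And>a. a \<in> qball \<Longrightarrow> norm (eval_r g a) \<le> 1" and z: "norm z < 1"
    and abs: "summable (\<lambda>k. norm (g k) * norm z ^ k)"
    and tail: "(\<Sum>k. norm (g (k + N)) * norm z ^ (k + N)) \<le> e"
  shows "norm (\<Sum>k<N. g k * q * z ^ k) \<le> (1 + e) * norm q"
proof -
  let ?h = "\<lambda>k. g k * q * z ^ k"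
  have s: "summable (\<lambda>k. norm (?h (k + N)))"
    using summable_mult[OF summable_ignore_initial_segment[OF abs, of N], of "norm q"]
    by (simp add: norm_mult norm_power mult_ac)
  have "norm (\<Sum>k. ?h (k + N)) \<le> (\<Sum>k. norm (?h (k + N)))"
    using s by (rule summable_norm)
  also have "\<dots> = (\<Sum>k. norm q * (norm (g (k + N)) * norm z ^ (k + N)))"
    by (simp add: norm_mult norm_power mult_ac)
  also have "\<dots> = norm q * (\<Sum>k. norm (g (k + N)) * norm z ^ (k + N))"
    using abs by (intro suminf_mult summable_ignore_initial_segment[of "\<lambda>k. norm (g k) * norm z ^ k"])
  also have "\<dots> \<le> norm q * e"
    using tail by (rule mult_left_mono) simp
  finally have t: "norm (\<Sum>k. ?h (k + N)) \<le> norm q * e" .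
  have "(\<Sum>k. ?h k) = (\<Sum>k. ?h (k + N)) + (\<Sum>k<N. ?h k)"
    by (rule suminf_split_initial_segment[OF summable_two_sided[OF abs]])
  then have "(\<Sum>k<N. ?h k) = (\<Sum>k. ?h k) - (\<Sum>k. ?h (k + N))"
    by simp
  then have "norm (\<Sum>k<N. ?h k) \<le> norm (\<Sum>k. ?h k) + norm (\<Sum>k. ?h (k + N))"
    by (simp add: norm_triangle_ineq4)
  then show ?thesis
    using t norm_two_sided_le[OF bnd z abs, of q] by (simp add: algebra_simps)
qed

text \<open>Powers of z commute with each other, so the double sum can be collected by m = j + k.
  The guard \<open>j \<le> m\<close> is needed because \<open>m - j\<close> is truncated.\<close>

lemma truncated_convolution:
  fixes g p :: "nat \<Rightarrow> quat"
  shows "(\<Sum>k<N. g k * (\<Sum>j<n. p j * z ^ j) * z ^ k)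
    = (\<Sum>m<N + n. (\<Sum>j<n. (if j \<le> m \<and> m - j < N then g (m - j) * p j else 0)) * z ^ m)"
proof -
  have shift: "(\<Sum>k<N. g k * p j * z ^ (j + k))
      = (\<Sum>m<N + n. if j \<le> m \<and> m - j < N then g (m - j) * p j * z ^ m else 0)" if "j < n" for j
  proof -
    have "(\<Sum>k<N. g k * p j * z ^ (j + k)) = (\<Sum>m\<in>{j..<j + N}. g (m - j) * p j * z ^ m)"
      by (rule sum.reindex_bij_witness[of _ "\<lambda>m. m - j" "\<lambda>k. j + k"]) auto
    also have "\<dots> = (\<Sum>m<N + n. if j \<le> m \<and> m - j < N then g (m - j) * p j * z ^ m else 0)"
      using that by (intro sum.mono_neutral_cong_left) auto
    finally show ?thesis .
  qed
  have "(\<Sum>k<N. g k * (\<Sum>j<n. p j * z ^ j) * z ^ k) = (\<Sum>j<n. \<Sum>k<N. g k * p j * z ^ (j + k))"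
    by (subst sum.swap) (simp add: sum_distrib_left sum_distrib_right power_add mult.assoc)
  also have "\<dots> = (\<Sum>j<n. \<Sum>m<N + n. if j \<le> m \<and> m - j < N then g (m - j) * p j * z ^ m else 0)"
    using shift by simp
  also have "\<dots> = (\<Sum>m<N + n. \<Sum>j<n. (if j \<le> m \<and> m - j < N then g (m - j) * p j else 0) * z ^ m)"
    by (subst sum.swap) (auto intro!: sum.cong)
  finally show ?thesis
    by (simp add: sum_distrib_right)
qed

text \<open>At each sample point w of the circle of radius r, take q = p(w) in
  \<open>norm_two_sided_partial_le\<close>. Summing the squares and applying discrete Parseval on
  both sides compares the coefficients of the convolution with those of p.\<close>

lemma toeplitz_contraction_radius:
  assumes bnd: "\<And>a. a \<in> qball \<Longrightarrow> norm (eval_r g a) \<le> 1"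
    and abs: "summable (\<lambda>k. norm (g k) * r ^ k)" and r: "0 \<le> r" "r < 1" and e: "e > 0"
  shows "(\<Sum>i<n. (norm (\<Sum>j<n. toeplitz g i j * p j) * r ^ i)\<^sup>2)
    \<le> (1 + e)\<^sup>2 * (\<Sum>j<n. (norm (p j) * r ^ j)\<^sup>2)"
proof (cases "n = 0")
  case False
  \<comment> \<open>N \<ge> n keeps the first n coefficients of the convolution free of truncation,
    so they are the entries of the Toeplitz product.\<close>
  obtain N where N: "N \<ge> n" "(\<Sum>k. norm (g (k + N)) * r ^ (k + N)) \<le> e"
  proof -
    obtain N0 where "\<And>N. N \<ge> N0 \<Longrightarrow> norm (\<Sum>k. norm (g (k + N)) * r ^ (k + N)) < e"
      using suminf_exist_split[OF e abs] by auto
    from this[of "max N0 n"] show ?thesis by (intro that[of "max N0 n"]) auto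
  qed
  \<comment> \<open>Exceeds the degree of the truncated product, so the samples determine its
    coefficients.\<close>
  define M where "M = N + n"
  define c where "c m = (\<Sum>j<n. (if j \<le> m \<and> m - j < N then g (m - j) * p j else 0))" for m
  define w where "w s = quat_of_complex (r * cis (2 * pi * s / M))" for s
  have nw: "norm (w s) = r" for s
    using r by (simp add: w_def norm_mult del: quat_of_complex_simps(5))
  have c: "c i = (\<Sum>j<n. toeplitz g i j * p j)" if "i < n" for i
    using that N unfolding c_def by (intro sum.cong) (auto simp: toeplitz_def)
  have "(\<Sum>i<n. (norm (\<Sum>j<n. toeplitz g i j * p j) * r ^ i)\<^sup>2) = (\<Sum>i<n. (norm (c i) * r ^ i)\<^sup>2)"
    using c by simp
  also have "\<dots> \<le> (\<Sum>i<M. (norm (c i) * r ^ i)\<^sup>2)"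
    by (rule sum_mono2) (auto simp: M_def)
  finally have "M * (\<Sum>i<n. (norm (\<Sum>j<n. toeplitz g i j * p j) * r ^ i)\<^sup>2) \<le> M * (\<Sum>i<M. (norm (c i) * r ^ i)\<^sup>2)"
    by (rule mult_left_mono) simp
  also have "\<dots> = (\<Sum>s<M. (norm (\<Sum>m<M. c m * w (real s) ^ m))\<^sup>2)"
    unfolding w_def using discrete_parseval_quat[of M M r c] r by simp
  also have "\<dots> = (\<Sum>s<M. (norm (\<Sum>k<N. g k * (\<Sum>j<n. p j * w (real s) ^ j) * w (real s) ^ k))\<^sup>2)"
    unfolding truncated_convolution c_def M_def ..
  also have "\<dots> \<le> (\<Sum>s<M. ((1 + e) * norm (\<Sum>j<n. p j * w (real s) ^ j))\<^sup>2)"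
    using r abs N(2) by (intro sum_mono power_mono norm_two_sided_partial_le[OF bnd]) (auto simp: nw)
  also have "\<dots> = (1 + e)\<^sup>2 * (\<Sum>s<M. (norm (\<Sum>j<n. p j * w (real s) ^ j))\<^sup>2)"
    by (simp add: power_mult_distrib sum_distrib_left)
  also have "\<dots> = M * ((1 + e)\<^sup>2 * (\<Sum>j<n. (norm (p j) * r ^ j)\<^sup>2))"
    unfolding w_def using discrete_parseval_quat[of n M r p] r by (simp add: M_def)
  finally show ?thesis
    using False by (subst (asm) mult_le_cancel_left_pos) (auto simp: M_def)
qed simp

lemma toeplitz_contraction:
  assumes bnd: "\<And>a. a \<in> qball \<Longrightarrow> norm (eval_r g a) \<le> 1"
    and abs: "\<And>r. 0 \<le> r \<Longrightarrow> r < 1 \<Longrightarrow> summable (\<lambda>k. norm (g k) * r ^ k)"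
  shows "(\<Sum>i<n. (norm (\<Sum>j<n. toeplitz g i j * p j))\<^sup>2) \<le> (\<Sum>j<n. (norm (p j))\<^sup>2)"
proof -
  define L where "L r = (\<Sum>i<n. (norm (\<Sum>j<n. toeplitz g i j * p j) * r ^ i)\<^sup>2)" for r
  \<comment> \<open>Choosing e = 1 - r removes the error and the radius in a single limit r
    \<rightarrow> 1.\<close>
  define R where "R r = (1 + (1 - r))\<^sup>2 * (\<Sum>j<n. (norm (p j) * r ^ j)\<^sup>2)" for r :: real
  have "(L \<longlongrightarrow> L 1) (at_left 1)" "(R \<longlongrightarrow> R 1) (at_left 1)"
    unfolding L_def R_def by (intro tendsto_intros)+
  moreover have "L r \<le> R r" if "r \<in> {0<..<1}" for r
    unfolding L_def R_def by (rule toeplitz_contraction_radius[OF bnd abs]) (use that in auto)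
  then have "\<forall>\<^sub>F r in at_left 1. L r \<le> R r"
    using eventually_at_left_real[OF zero_less_one] by (rule eventually_mono[rotated])
  ultimately have "L 1 \<le> R 1"
    by (intro tendsto_le[of "at_left 1" R "R 1" L "L 1"]) auto
  then show ?thesis
    by (simp add: L_def R_def)
qed

text \<open>With \<open>y = T\<^sup>* x\<close>, expanding \<open>0 \<le> \<parallel>x - T y\<parallel>\<^sup>2\<close> passes from \<open>T\<close> to its adjoint.\<close>

lemma qpsd_of_contraction:
  fixes T :: "nat \<Rightarrow> nat \<Rightarrow> quat"
  assumes contr: "\<And>p. (\<Sum>i<n. (norm (\<Sum>j<n. T i j * p j))\<^sup>2) \<le> (\<Sum>j<n. (norm (p j))\<^sup>2)"
  shows "qpsd n (\<lambda>i j. (if i = j then 1 else 0) - (\<Sum>l<n. T i l * qcnj (T j l)))"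
  unfolding qpsd_def
proof (intro conjI allI impI)
  show "(if i = j then 1 else 0) - (\<Sum>l<n. T i l * qcnj (T j l))
      = qcnj ((if j = i then 1 else 0) - (\<Sum>l<n. T j l * qcnj (T i l)))" for i j
    by (simp add: qcnj_sum)
next
  fix x :: "nat \<Rightarrow> quat"
  define y where "y l = (\<Sum>i<n. qcnj (T i l) * x i)" for l
  define w where "w i = (\<Sum>l<n. T i l * y l)" for i
  define X Y where XY: "X = (\<Sum>i<n. (norm (x i))\<^sup>2)" "Y = (\<Sum>l<n. (norm (y l))\<^sup>2)"
  have sumY: "(\<Sum>l<n. qcnj (y l) * y l) = Y *\<^sub>R 1"
    by (simp add: XY qcnj_mult_quat scaleR_sum_left)
  have form: "(\<Sum>i<n. \<Sum>j<n. qcnj (x i) * ((if i = j then 1 else 0) - (\<Sum>l<n. T i l * qcnj (T j l))) * x j)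
      = (X - Y) *\<^sub>R 1"
  proof -
    have "(\<Sum>i<n. \<Sum>j<n. qcnj (x i) * ((if i = j then 1 else 0) - (\<Sum>l<n. T i l * qcnj (T j l))) * x j)
        = (\<Sum>i<n. \<Sum>j<n. if i = j then qcnj (x i) * x i else 0)
          - (\<Sum>i<n. \<Sum>j<n. \<Sum>l<n. qcnj (x i) * T i l * (qcnj (T j l) * x j))"
      unfolding sum_subtractf[symmetric]
      by (intro sum.cong refl) (simp add: right_diff_distrib left_diff_distrib sum_distrib_left sum_distrib_right mult.assoc)
    also have "(\<Sum>i<n. \<Sum>j<n. if i = j then qcnj (x i) * x i else 0) = X *\<^sub>R 1"
      by (simp add: XY qcnj_mult_quat scaleR_sum_left)
    also have "(\<Sum>i<n. \<Sum>j<n. \<Sum>l<n. qcnj (x i) * T i l * (qcnj (T j l) * x j))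
        = (\<Sum>i<n. \<Sum>l<n. \<Sum>j<n. qcnj (x i) * T i l * (qcnj (T j l) * x j))"
      by (rule sum.cong[OF refl], rule sum.swap)
    also have "\<dots> = (\<Sum>l<n. \<Sum>i<n. \<Sum>j<n. qcnj (x i) * T i l * (qcnj (T j l) * x j))"
      by (rule sum.swap)
    also have "\<dots> = (\<Sum>l<n. qcnj (y l) * y l)"
      by (simp add: y_def qcnj_sum sum_product)
    finally show ?thesis
      by (simp add: sumY scaleR_left_diff_distrib)
  qed
  \<comment> \<open>Moving T to the other side of the inner product of w = T y with x turns x into
    y.\<close>
  have "(\<Sum>i<n. qcnj (w i) * x i) = (\<Sum>i<n. \<Sum>l<n. qcnj (y l) * (qcnj (T i l) * x i))"
    by (simp add: w_def qcnj_sum sum_distrib_right mult.assoc)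
  also have "\<dots> = (\<Sum>l<n. qcnj (y l) * y l)"
    by (subst sum.swap) (simp add: y_def sum_distrib_left)
  finally have wx: "(\<Sum>i<n. qre (qcnj (w i) * x i)) = Y"
    using sumY linear_sum[OF bounded_linear.linear[OF bounded_linear_qre], of "\<lambda>i. qcnj (w i) * x i" "{..<n}"]
    by (simp del: quat_mult_simps)
  have "(norm (x i - w i))\<^sup>2 = (norm (x i))\<^sup>2 - 2 * qre (qcnj (w i) * x i) + (norm (w i))\<^sup>2" for i
    unfolding norm_quat_power2 by (simp add: power2_eq_square algebra_simps)
  \<comment> \<open>Contractivity bounds the last sum by Y, whence 0 \<le> X - 2 Y + Y = X -
    Y.\<close>
  then have "(\<Sum>i<n. (norm (x i - w i))\<^sup>2) = X - 2 * Y + (\<Sum>i<n. (norm (w i))\<^sup>2)"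
    by (simp add: sum.distrib sum_subtractf XY(1) wx sum_distrib_left[symmetric] del: quat_mult_simps)
  moreover have "(\<Sum>i<n. (norm (w i))\<^sup>2) \<le> Y"
    using contr[of y] by (simp add: w_def XY)
  moreover have "(\<Sum>i<n. (norm (x i - w i))\<^sup>2) \<ge> 0"
    by (simp add: sum_nonneg)
  ultimately have "X - Y \<ge> 0"
    by linarith
  then show "qnonneg (\<Sum>i<n. \<Sum>j<n. qcnj (x i) * ((if i = j then 1 else 0) - (\<Sum>l<n. T i l * qcnj (T j l))) * x j)"
    unfolding form by (simp add: qnonneg_def)
qed

section \<open>Coefficients of Schur class series\<close>

text \<open>Testing with the last unit vector isolates a diagonal entry: 1 minus the squared norm of
  the last row of the Toeplitz matrix, whose column 0 holds \<open>g k\<close>.\<close>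

lemma norm_coeff_le_1:
  assumes psd: "qpsd (Suc k) (\<lambda>i j. (if i = j then 1 else 0) - (\<Sum>l<Suc k. toeplitz g i l * qcnj (toeplitz g j l)))"
  shows "norm (g k) \<le> 1"
proof -
  define A where "A = (\<lambda>i j. (if i = j then 1 else 0) - (\<Sum>l<Suc k. toeplitz g i l * qcnj (toeplitz g j l)))"
  define x where "x i = (if i = k then 1 else 0 :: quat)" for i
  have "(\<Sum>i<Suc k. \<Sum>j<Suc k. qcnj (x i) * A i j * x j) = (\<Sum>i<Suc k. \<Sum>j<Suc k. if i = k \<and> j = k then A k k else 0)"
    by (intro sum.cong) (auto simp: x_def)
  also have "\<dots> = A k k"
    by simp
  finally have form: "(\<Sum>i<Suc k. \<Sum>j<Suc k. qcnj (x i) * A i j * x j) = A k k" .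
  have "qnonneg (\<Sum>i<Suc k. \<Sum>j<Suc k. qcnj (x i) * A i j * x j)"
    using psd unfolding qpsd_def A_def by blast
  then have "qnonneg (A k k)"
    unfolding form .
  then have "0 \<le> qre (A k k)"
    by (simp add: qnonneg_def)
  also have "A k k = (1 - (\<Sum>l<Suc k. (norm (toeplitz g k l))\<^sup>2)) *\<^sub>R 1"
    unfolding A_def quat_mult_qcnj scaleR_left_diff_distrib scaleR_sum_left by simp
  finally have "(\<Sum>l<Suc k. (norm (toeplitz g k l))\<^sup>2) \<le> 1"
    by simp
  moreover have "(norm (toeplitz g k 0))\<^sup>2 \<le> (\<Sum>l<Suc k. (norm (toeplitz g k l))\<^sup>2)"
    by (rule member_le_sum) auto
  ultimately have "(norm (g k))\<^sup>2 \<le> 1"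
    by (simp add: toeplitz_def)
  then show ?thesis
    by (simp add: power_le_one_iff abs_square_le_1)
qed

lemma QS_norm_coeff_le_1:
  assumes "g \<in> QS"
  shows "norm (g k) \<le> 1"
  using assms by (intro norm_coeff_le_1) (auto simp: QS_def)

lemma qfps_if_norm_le_1:
  assumes "\<And>k. norm (g k) \<le> 1"
  shows "qfps g"
  unfolding qfps_def
proof (rule Limsup_bounded, rule always_eventually, rule allI)
  show "ereal (root k (norm (g k))) \<le> 1" for k
    \<comment> \<open>\<open>root 0\<close> is constantly 0, so the index 0 is treated
      separately.\<close>
    using assms[of k] by (cases "k = 0") auto
qed

lemma power_series_unique:
  fixes a b :: "nat \<Rightarrow> complex"
  assumes sum: "\<And>z. norm z < 1 \<Longrightarrow> summable (\<lambda>k. a k * z ^ k)" "\<And>z. norm z < 1 \<Longrightarrow> summable (\<lambda>k. b k * z ^ k)"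
    and eq: "\<And>z. norm z < 1 \<Longrightarrow> (\<Sum>k. a k * z ^ k) = (\<Sum>k. b k * z ^ k)"
  shows "a = b"
proof -
  have "conv_radius c > 0" if "\<And>z. norm z < 1 \<Longrightarrow> summable (\<lambda>k. c k * z ^ k)" for c :: "nat \<Rightarrow> complex"
  proof -
    \<comment> \<open>One nonzero point of convergence suffices for a positive radius.\<close>
    have "ereal (norm (1 / 2 :: complex)) \<le> conv_radius c"
      by (rule conv_radius_geI) (use that in auto)
    then show ?thesis by (auto intro: less_le_trans[rotated])
  qed
  then have "fps_conv_radius (Abs_fps a) > 0" "fps_conv_radius (Abs_fps b) > 0"
    using sum by (auto simp: fps_conv_radius_def)
  moreover have "\<forall>\<^sub>F z in nhds 0. z \<in> ball (0::complex) 1"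
    by (rule eventually_nhds_in_open) auto
  then have "\<forall>\<^sub>F z in nhds 0. eval_fps (Abs_fps a) z = eval_fps (Abs_fps b) z"
    by (rule eventually_mono) (use eq in \<open>auto simp: eval_fps_def\<close>)
  ultimately have "Abs_fps a = Abs_fps b"
    by (rule eval_fps_eqD)
  then show ?thesis
    by (simp add: fps_eq_iff fun_eq_iff)
qed

text \<open>Agreement on the slice already suffices: there the components are complex power series,
  and these determine their coefficients.\<close>

lemma eval_r_inject:
  assumes abs: "\<And>r. 0 \<le> r \<Longrightarrow> r < 1 \<Longrightarrow> summable (\<lambda>k. norm (g k) * r ^ k)"
    "\<And>r. 0 \<le> r \<Longrightarrow> r < 1 \<Longrightarrow> summable (\<lambda>k. norm (h k) * r ^ k)"
    and eq: "\<And>a. a \<in> qball \<Longrightarrow> eval_r g a = eval_r h a"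
  shows "g = h"
proof -
  have s: "(\<lambda>k. g k * quat_of_complex z ^ k) sums eval_r g (quat_of_complex z)"
    "(\<lambda>k. h k * quat_of_complex z ^ k) sums eval_r g (quat_of_complex z)" if "norm z < 1" for z
    using eval_r_sums[of g "quat_of_complex z"] eval_r_sums[of h "quat_of_complex z"]
      abs[of "norm z"] eq[of "quat_of_complex z"] that by (auto simp: qball_def)
  note s1 = bounded_linear.sums[OF bounded_linear_cpart1 s(1), simplified]
    bounded_linear.sums[OF bounded_linear_cpart1 s(2), simplified]
  note s2 = bounded_linear.sums[OF bounded_linear_cpart2 s(1), simplified]
    bounded_linear.sums[OF bounded_linear_cpart2 s(2), simplified]
  have "(\<lambda>k. cpart1 (g k)) = (\<lambda>k. cpart1 (h k))"
    using s1 by (intro power_series_unique) (auto simp: sums_iff)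
  moreover have "(\<lambda>k. cpart2 (g k)) = (\<lambda>k. cpart2 (h k))"
    using s2 by (intro power_series_unique) (auto simp: sums_iff)
  ultimately show ?thesis
    by (simp add: fun_eq_iff quat_eq_cparts_iff)
qed

theorem theorem3p2:
  fixes f :: "quat \<Rightarrow> quat"
  assumes "\<forall>z1\<in>qball. \<forall>z2\<in>qball. \<forall>z3\<in>qball. qpsd 3 (dual_pick f [z1, z2, z3])"
  shows "\<exists>!g. g \<in> QS \<and> (\<forall>a\<in>qball. f a = eval_r g a)"
proof -
  interpret dual_pick3 f
    using assms by unfold_locales blast
  obtain g where abs: "\<And>r. 0 \<le> r \<Longrightarrow> r < 1 \<Longrightarrow> summable (\<lambda>k. norm (g k) * r ^ k)"
    and slice: "\<And>z. norm z < 1 \<Longrightarrow> eval_r g (quat_of_complex z) = f (quat_of_complex z)"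
    using power_series_on_slice by blast
  have eval: "eval_r g a = f a" if "a \<in> qball" for a
    using eval_r_eq_on_ball[OF abs slice that] .
  have psd: "qpsd n (\<lambda>i j. (if i = j then 1 else 0) - (\<Sum>l<n. toeplitz g i l * qcnj (toeplitz g j l)))" for n
    using norm_le_1 eval by (intro qpsd_of_contraction toeplitz_contraction abs) auto
  then have g: "g \<in> QS"
    by (auto simp: QS_def intro!: qfps_if_norm_le_1 norm_coeff_le_1)
  have "h = g" if h: "h \<in> QS" "\<forall>a\<in>qball. f a = eval_r h a" for h
  proof (rule eval_r_inject)
    \<comment> \<open>Coefficients of a Schur class series are bounded by 1, so the geometric series
      dominates.\<close>
    show "summable (\<lambda>k. norm (h k) * r ^ k)" if "0 \<le> r" "r < 1" for r :: real
    proof (rule summable_comparison_test'[of "\<lambda>k. r ^ k"])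
      show "norm (norm (h k) * r ^ k) \<le> r ^ k" for k
        using mult_right_mono[OF QS_norm_coeff_le_1[OF h(1), of k], of "r ^ k"] that by simp
    qed (use that in \<open>auto simp: summable_geometric\<close>)
  qed (use abs h eval in auto)
  moreover have "\<forall>a\<in>qball. f a = eval_r g a"
    using eval by simp
  ultimately show ?thesis
    using g by blast
qed

end
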